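(* Let $d\ge 1$, let $\Gamma^{*}\subset\mathbb{R}^{d}$ be a (full-rank) lattice and let $\mathcal{B}\subset\mathbb{R}^{d}$ be a unit cell of $\Gamma^{*}$. Let $\eta>0$ and let $I$ be a complex-valued function that is analytic (holomorphic) in an open subset of $\mathbb{C}^{d}$ containing $U=\mathbb{R}^{d}+i[-\eta,\eta]^{d}$ and $\Gamma^{*}$-periodic, i.e. $I(\mathbf{k}+\mathbf{K})=I(\mathbf{k})$ for all $\mathbf{k}\in U$ and $\mathbf{K}\in\Gamma^{*}$. Then for every $\Gamma^{*}$-periodic and continuously differentiable function $\mathbf{h}:\mathbb{R}^{d}\to[-\eta,\eta]^{d}$, setting $\boldsymbol{\kappa}(\mathbf{k})=\mathbf{k}+i\mathbf{h}(\mathbf{k})$ for $\mathbf{k}\in\mathbb{R}^{d}$, one has $$\int_{\mathcal{B}} I(\mathbf{k})\,d\mathbf{k}=\int_{\mathcal{B}} I(\boldsymbol{\kappa}(\mathbf{k}))\,\det(\boldsymbol{\kappa}'(\mathbf{k}))\,d\mathbf{k}=\int_{\mathcal{B}} I(\mathbf{k}+i\mathbf{h}(\mathbf{k}))\,\det\bigl(1+i\mathbf{h}'(\mathbf{k})\bigr)\,d\mathbf{k}.$$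
   Context: $\Gamma^{*}$ is the reciprocal lattice of a $d$-dimensional lattice $\Gamma\subset\mathbb{R}^{d}$, that is, the set of $\mathbf{K}\in\mathbb{R}^{d}$ such that $\mathbf{K}\cdot\mathbf{T}\in 2\pi\mathbb{Z}$ for all $\mathbf{T}\in\Gamma$; any full-rank lattice of $\mathbb{R}^d$ arises this way. The Brillouin zone $\mathcal{B}$ is a unit cell (fundamental domain, e.g. the half-open parallelepiped spanned by a basis of $\Gamma^*$) of $\Gamma^{*}$. The set $\mathbb{R}^{d}+i[-\eta,\eta]^{d}$ consists of all $\mathbf{x}+i\mathbf{y}\in\mathbb{C}^{d}$ with $\mathbf{x}\in\mathbb{R}^{d}$ and $\mathbf{y}\in[-\eta,\eta]^{d}$. For a differentiable map, the prime denotes the $d\times d$ Jacobian matrix with respect to the real variable $\mathbf{k}$, so $\boldsymbol{\kappa}'(\mathbf{k})=1+i\mathbf{h}'(\mathbf{k})$ with $1$ the $d\times d$ identity matrix. A function on $\mathbb{R}^{d}$ is $\Gamma^{*}$-periodic if it is invariant under translation by every element of $\Gamma^{*}$. $d\mathbf{k}$ is Lebesgue measure on $\mathbb{R}^d$. *)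

theory Defs
  imports "HOL-Analysis.Analysis"
begin

definition complexify :: "real ^ 'n \<Rightarrow> complex ^ 'n"
  where "complexify x = (\<chi> i. complex_of_real (x $ i))"

definition full_rank_lattice :: "(real ^ 'n) set \<Rightarrow> bool"
  where "full_rank_lattice L \<longleftrightarrow>
    (\<exists>b :: 'n \<Rightarrow> real ^ 'n. inj b \<and> independent (range b) \<and>
       L = range (\<lambda>c :: 'n \<Rightarrow> int. \<Sum>i\<in>UNIV. real_of_int (c i) *\<^sub>R b i))"

text \<open>A fundamental domain up to null sets, so that half-open parallelepipeds as well as closed
  Voronoi cells (whose translates overlap on their boundaries) are unit cells. No shape or
  boundedness is imposed; finiteness of the volume is a consequence.\<close>
definition unit_cell :: "(real ^ 'n) set \<Rightarrow> (real ^ 'n) set \<Rightarrow> bool"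
  where "unit_cell L B \<longleftrightarrow>
    B \<in> sets lebesgue \<and> (AE x in lebesgue. \<exists>!K. K \<in> L \<and> x - K \<in> B)"

definition tube :: "real \<Rightarrow> (complex ^ 'n) set"
  where "tube \<eta> = {complexify x + \<i> *s complexify y | x y. \<forall>i. y $ i \<in> {- \<eta>..\<eta>}}"

text \<open>Holomorphy in several variables: the real Frechet derivative exists and is complex linear.
  This is meant for open \<open>W\<close>.\<close>
definition holomorphic_several_on :: "(complex ^ 'n \<Rightarrow> complex) \<Rightarrow> (complex ^ 'n) set \<Rightarrow> bool"
  where "holomorphic_several_on f W \<longleftrightarrow>
    (\<forall>z\<in>W. \<exists>D. (f has_derivative D) (at z) \<and> Vector_Spaces.linear (*s) (*) D)"

definition continuously_differentiable :: "(real ^ 'n \<Rightarrow> real ^ 'm) \<Rightarrow> bool"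
  where "continuously_differentiable f \<longleftrightarrow>
    (\<forall>k. f differentiable (at k)) \<and> continuous_on UNIV (\<lambda>k. jacobian f (at k))"

text \<open>The library's \<open>jacobian\<close> only covers real-valued components.\<close>
definition complex_jacobian :: "(real ^ 'n \<Rightarrow> complex ^ 'm) \<Rightarrow> real ^ 'n \<Rightarrow> complex ^ 'n ^ 'm"
  where "complex_jacobian f k = (\<chi> i j. frechet_derivative f (at k) (axis j 1) $ i)"

end

theory Submission
  imports Defs "HOL-Complex_Analysis.Conformal_Mappings"
begin

text \<open>
  For \<open>s \<in> \<complex>\<close> with \<open>|Im s| \<le> 1\<close> let \<open>G s\<close> be the integral of
  \<open>I (k + s h(k)) det (1 + s h'(k))\<close> over the unit cell. For small real \<open>s\<close> the map
  \<open>k \<mapsto> k + s h(k)\<close> is a \<open>C\<^sup>1\<close> diffeomorphism commuting with lattice translations, so it sends a unit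
  cell to a unit cell, and the change of variables formula gives \<open>G s = G 0\<close>. By Morera \<open>G\<close> is
  holomorphic in the open strip, hence constant there by the identity theorem, and by continuity
  \<open>G \<i> = G 0\<close>. In contrast to a Stokes argument, this needs no second derivatives of \<open>h\<close>.
\<close>

text \<open>The substitution is a real one only for real \<open>s\<close>; there the integrand is
  the pullback of the restriction of \<open>I\<close> to real points, which is why the comparison
  with \<open>s = 0\<close> is made on a real interval. The bound \<open>|Im s| \<le> 1\<close> is
  what keeps \<open>k + s h(k)\<close> in the tube, so \<open>\<i>\<close> lies on the boundary of
  the strip and is reached as a limit. The unit cell \<open>B\<close> may be unbounded or irregular.
  Integrals of periodic functions are therefore moved to the parallelepiped spanned by a lattice
  basis, and from there to the closed unit cube: a compact domain independent of \<open>s\<close>,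
  on which joint continuity suffices for all parametric arguments. "Small" means
  \<open>|s| < 1 / M\<close>, where \<open>M\<close> bounds the operator norm of \<open>h'\<close>;
  it is finite because \<open>h'\<close> is continuous and periodic. The inequality
  \<open>|s| M < 1\<close> serves twice: it makes the substitution bijective by a fixed point
  argument, and it makes the Jacobian determinant positive. The latter removes the absolute value
  from the change of variables formula, leaving a polynomial in \<open>s\<close> that makes sense
  for complex \<open>s\<close>.\<close>

section \<open>Change of variables without an order on the index type\<close>

text \<open>The library proves the change of variables formula only for well-ordered index types; it is
  transported to an arbitrary finite one through this copy.\<close>
typedef 'a ranked = "{..<CARD('a::finite)}"
  by (auto intro: exI[of _ 0])

instance ranked :: (finite) finite
proof
  have "Rep_ranked ` (UNIV :: 'a ranked set) \<subseteq> {..<CARD('a)}"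
    using Rep_ranked by blast
  then show "finite (UNIV :: 'a ranked set)"
    by (meson Rep_ranked_inject finite_imageD finite_lessThan finite_subset injI)
qed

instantiation ranked :: (finite) linorder
begin
definition less_eq_ranked :: "'a ranked \<Rightarrow> 'a ranked \<Rightarrow> bool"
  where "less_eq_ranked x y \<longleftrightarrow> Rep_ranked x \<le> Rep_ranked y"
definition less_ranked :: "'a ranked \<Rightarrow> 'a ranked \<Rightarrow> bool"
  where "less_ranked x y \<longleftrightarrow> Rep_ranked x < Rep_ranked y"
instance
  by standard (auto simp: less_eq_ranked_def less_ranked_def Rep_ranked_inject)
end

instance ranked :: (finite) wellorder
proof (rule wf_wellorderI)
  show "wf {(x :: 'a ranked, y). x < y}"
    by (rule wf_subset[OF wf_measure[of Rep_ranked]]) (auto simp: less_ranked_def)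
qed intro_classes

lemma ex_bij_ranked: "\<exists>\<tau> :: 'n::finite ranked \<Rightarrow> 'n. bij \<tau>"
proof -
  have "CARD('n ranked) = CARD('n)"
    using type_definition.card[OF type_definition_ranked[where 'a = 'n]] by simp
  then show ?thesis
    using finite_same_card_bij[of "UNIV :: 'n ranked set" "UNIV :: 'n set"] by auto
qed

text \<open>A Borel map can fail to be Lebesgue measurable because preimages of null sets may not be
  null. Preservation of the measure excludes this, so the map passes to the completion.\<close>

lemma distr_lebesgue_eqI:
  fixes T :: "'a::euclidean_space \<Rightarrow> 'b::euclidean_space"
  assumes T: "T \<in> borel_measurable borel" and eq: "distr lborel borel T = lborel"
  shows "T \<in> lebesgue \<rightarrow>\<^sub>M lebesgue" and "distr lebesgue lebesgue T = lebesgue"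
proof -
  have T': "T \<in> lborel \<rightarrow>\<^sub>M lborel" using T by simp
  have eq': "distr lborel lborel T = lborel" 
    using eq by (simp cong: distr_cong)
  have eq2: "distr lebesgue lborel T = lborel"
    using distr_completion[OF T'] eq' by simp
  have m: "T \<in> lebesgue \<rightarrow>\<^sub>M lborel" using T' by (rule measurable_completion)
  then show "T \<in> lebesgue \<rightarrow>\<^sub>M lebesgue"
    by (rule completion.measurable_completion2) (simp add: eq2)
  show "distr lebesgue lebesgue T = lebesgue"
    using completion.completion_distr_eq[OF m] eq2 by simp
qed

lemma prod_Basis_cart: "(\<Prod>b\<in>Basis. (x :: real ^ 'n) \<bullet> b) = (\<Prod>i\<in>UNIV. x $ i)"
proof -
  have "Basis = range (\<lambda>i::'n. axis i (1::real))" by (auto simp: Basis_vec_def)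
  moreover have "inj (\<lambda>i::'n. axis i (1::real))" by (auto simp: inj_on_def axis_eq_axis)
  ultimately show ?thesis
    by (subst \<open>Basis = _\<close>, subst prod.reindex) (simp_all add: inner_axis)
qed

text \<open>Lebesgue measure is determined by its values on boxes, and the preimage of a box is the
  box with its sides relabelled, which has the same product of side lengths.\<close>

lemma distr_lborel_reindex:
  fixes \<sigma> :: "'n::finite \<Rightarrow> 'm::finite"
  assumes "bij \<sigma>"
  shows "distr lborel borel (\<lambda>x :: real ^ 'm. \<chi> i. x $ \<sigma> i) = lborel"
proof (rule lborel_eqI[symmetric])
  let ?T = "\<lambda>x :: real ^ 'm. (\<chi> i. x $ \<sigma> i)"
  let ?S = "\<lambda>x :: real ^ 'n. (\<chi> i. x $ inv \<sigma> i)"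
  have [measurable]: "?T \<in> borel_measurable borel"
    by (intro borel_measurable_continuous_onI continuous_intros)
  have inv: "inv \<sigma> (\<sigma> i) = i" "\<sigma> (inv \<sigma> j) = j" for i j
    using assms by (auto simp: bij_is_inj surj_f_inv_f bij_is_surj)
  have ball: "(\<forall>j. R j (inv \<sigma> j)) \<longleftrightarrow> (\<forall>i. R (\<sigma> i) i)" for R
    by (metis inv)
  fix l u :: "real ^ 'n" assume le: "\<And>b. b \<in> Basis \<Longrightarrow> l \<bullet> b \<le> u \<bullet> b"
  have le': "l $ i \<le> u $ i" for i
    using le[of "axis i 1"] by (simp add: inner_axis)
  have vim: "?T -` box l u = box (?S l) (?S u)"
    using ball[of "\<lambda>j i. l $ i < x $ j \<and> x $ j < u $ i" for x :: "real ^ 'm"]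
    by (auto simp: mem_box_cart inv)
  have "emeasure lborel (box (?S l) (?S u)) = ennreal (\<Prod>j\<in>UNIV. (?S u - ?S l) $ j)"
    using le' prod_Basis_cart[of "?S u - ?S l"]
    by (subst emeasure_lborel_box) (auto simp: Basis_vec_def inner_axis)
  also have "(\<Prod>j\<in>UNIV. (?S u - ?S l) $ j) = (\<Prod>i\<in>UNIV. (u - l) $ i)"
    using prod.reindex_bij_betw[OF assms, of "\<lambda>j. (?S u - ?S l) $ j"] by (simp add: inv)
  finally show "emeasure (distr lborel borel ?T) (box l u) = ennreal (\<Prod>b\<in>Basis. (u - l) \<bullet> b)"
    by (simp add: emeasure_distr vim prod_Basis_cart)
qed simp

text \<open>Conjugation by \<tau> is a sign-preserving bijection between the permutations of the two
  index types, and it matches the terms of the two Leibniz sums.\<close>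

lemma det_reindex:
  fixes M :: "'a::comm_ring_1 ^ 'n ^ 'n" and \<tau> :: "'m::finite \<Rightarrow> 'n::finite"
  assumes "bij \<tau>"
  shows "det (\<chi> i j. M $ \<tau> i $ \<tau> j) = det M"
proof -
  let ?\<sigma> = "inv \<tau>"
  have inv: "?\<sigma> (\<tau> i) = i" "\<tau> (?\<sigma> j) = j" for i j
    using assms by (auto simp: bij_is_inj surj_f_inv_f bij_is_surj)
  have b: "bij_betw (\<lambda>p. \<tau> \<circ> p \<circ> ?\<sigma>) {p. p permutes (UNIV :: 'm set)} {p. p permutes (UNIV :: 'n set)}"
  proof (rule bij_betwI[where g = "\<lambda>q. ?\<sigma> \<circ> q \<circ> \<tau>"])
    show "(\<lambda>p. \<tau> \<circ> p \<circ> ?\<sigma>) \<in> {p. p permutes UNIV} \<rightarrow> {p. p permutes UNIV}"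
      using assms by (auto intro!: bij_imp_permutes bij_comp bij_imp_bij_inv dest: permutes_bij)
    show "(\<lambda>q. ?\<sigma> \<circ> q \<circ> \<tau>) \<in> {p. p permutes UNIV} \<rightarrow> {p. p permutes UNIV}"
      using assms by (auto intro!: bij_imp_permutes bij_comp bij_imp_bij_inv dest: permutes_bij)
  qed (auto simp: fun_eq_iff inv)
  have sgn: "sign (\<tau> \<circ> p \<circ> ?\<sigma>) = sign p" if "p permutes UNIV" for p :: "'m \<Rightarrow> 'm"
    using sign_map_permutation[of \<tau> UNIV p] that assms
    by (simp add: map_permutation_def bij_is_inj bij_is_surj restrict_id_def o_def)
  have "det M = (\<Sum>q | q permutes UNIV. of_int (sign q) * (\<Prod>i\<in>UNIV. M $ i $ q i))"
    by (simp add: det_def)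
  also have "\<dots> = (\<Sum>p | p permutes UNIV. of_int (sign p) * (\<Prod>i\<in>UNIV. M $ \<tau> i $ \<tau> (p i)))"
    by (subst sum.reindex_bij_betw[OF b, symmetric], intro sum.cong refl,
        subst prod.reindex_bij_betw[OF assms, symmetric]) (simp add: sgn inv)
  finally show ?thesis by (simp add: det_def)
qed

lemma set_integral_change_of_variables_wellorder:
  fixes f :: "real ^ 'm::{finite,wellorder} \<Rightarrow> complex" and g :: "real ^ 'm::_ \<Rightarrow> real ^ 'm::_"
  assumes S: "S \<in> sets lebesgue"
    and der: "\<And>x. x \<in> S \<Longrightarrow> (g has_derivative g' x) (at x within S)"
    and inj: "inj_on g S"
    and f: "set_integrable lebesgue (g ` S) f"
  shows "set_integrable lebesgue S (\<lambda>x. \<bar>det (matrix (g' x))\<bar> *\<^sub>R f (g x))"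
    and "(LINT x:g ` S|lebesgue. f x) = (LINT x:S|lebesgue. \<bar>det (matrix (g' x))\<bar> *\<^sub>R f (g x))"
proof -
  \<comment> \<open>The maps \<open>u\<close> and \<open>v\<close> identify the complex numbers with
    \<open>real ^ 2\<close>: the vector-valued change of variables formula is applied to
    \<open>u \<circ> f\<close>, and the result is carried back by the linear map
    \<open>v\<close>.\<close>
  define u :: "complex \<Rightarrow> real ^ 2" where "u z = (\<chi> i. if i = 1 then Re z else Im z)" for z
  define v :: "real ^ 2 \<Rightarrow> complex" where "v w = Complex (w $ 1) (w $ 2)" for w
  have u: "bounded_linear u" 
    by (rule bounded_linear_intro[where K = 2])
      (auto simp: u_def vec_eq_iff norm_vec_def L2_set_def UNIV_2 cmod_def)
  have v: "bounded_linear v"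
    by (rule bounded_linear_intro[where K = 1])
      (auto simp: v_def complex_eq_iff norm_vec_def L2_set_def UNIV_2 cmod_def)
  have vu: "v (u z) = z" for z by (simp add: u_def v_def)
  have scale: "v (c *\<^sub>R u z) = c *\<^sub>R z" for c z
    using vu v by (simp add: linear_simps(5))
  let ?F = "\<lambda>x. \<bar>det (matrix (g' x))\<bar> *\<^sub>R (u \<circ> f) (g x)"
  have uf: "(u \<circ> f) absolutely_integrable_on (g ` S)"
    using f u by (rule absolutely_integrable_linear)
  then have F: "?F absolutely_integrable_on S" "integral S ?F = integral (g ` S) (u \<circ> f)"
    using has_absolute_integral_change_of_variables[OF S der inj, of "u \<circ> f"] by blast+
  have vF: "v \<circ> ?F = (\<lambda>x. \<bar>det (matrix (g' x))\<bar> *\<^sub>R f (g x))"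
    by (auto simp: scale)
  show int: "set_integrable lebesgue S (\<lambda>x. \<bar>det (matrix (g' x))\<bar> *\<^sub>R f (g x))"
    using absolutely_integrable_linear[OF F(1) v] by (simp only: vF)
  have "integral (g ` S) f = integral (g ` S) (v \<circ> (u \<circ> f))"
    by (simp add: vu o_def)
  also have "\<dots> = v (integral (g ` S) (u \<circ> f))"
    using uf v by (intro integral_linear) (auto intro: set_lebesgue_integral_eq_integral)
  also have "\<dots> = integral S (v \<circ> ?F)"
    using F v by (subst integral_linear) (auto intro: set_lebesgue_integral_eq_integral)
  finally show "(LINT x:g ` S|lebesgue. f x) = (LINT x:S|lebesgue. \<bar>det (matrix (g' x))\<bar> *\<^sub>R f (g x))"
    using f int by (simp only: set_lebesgue_integral_eq_integral vF)
qed

lemma set_integral_vimage: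
  fixes F :: "'b::euclidean_space \<Rightarrow> 'c::{banach, second_countable_topology}"
  assumes T: "T \<in> lebesgue \<rightarrow>\<^sub>M lebesgue" "distr lebesgue lebesgue T = lebesgue"
    and F: "set_integrable lebesgue X F"
  shows "set_integrable lebesgue (T -` X) (\<lambda>x. F (T x))"
    and "(LINT x:X|lebesgue. F x) = (LINT x:T -` X|lebesgue. F (T x))"
proof -
  let ?H = "\<lambda>x. indicator X x *\<^sub>R F x"
  have H: "integrable lebesgue ?H" using F by (simp add: set_integrable_def)
  have ind: "indicator (T -` X) x = (indicator X (T x) :: real)" for x
    by (simp add: indicator_def)
  have "integrable lebesgue (\<lambda>x. ?H (T x))"
    using integrable_distr[OF T(1), of ?H] H T(2) by simp
  then show "set_integrable lebesgue (T -` X) (\<lambda>x. F (T x))"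
    by (simp add: set_integrable_def ind)
  show "(LINT x:X|lebesgue. F x) = (LINT x:T -` X|lebesgue. F (T x))"
    using integral_distr[OF T(1), of ?H] H T(2)
    by (simp add: set_lebesgue_integral_def ind)
qed

text \<open>The map \<open>g\<close> is conjugated by the relabelling isomorphisms \<open>P\<close>
  and \<open>Q\<close> between \<open>real ^ 'n\<close> and \<open>real ^ 'n ranked\<close>. They
  preserve Lebesgue measure, and the conjugation leaves the Jacobian determinant unchanged, so the
  formula for well-ordered indices carries over.\<close>

lemma set_integral_change_of_variables:
  fixes f :: "real ^ 'n \<Rightarrow> complex" and g :: "real ^ 'n \<Rightarrow> real ^ 'n"
  assumes S: "S \<in> sets lebesgue"
    and der: "\<And>x. x \<in> S \<Longrightarrow> (g has_derivative g' x) (at x within S)"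
    and inj: "inj_on g S"
    and f: "set_integrable lebesgue (g ` S) f"
  shows "set_integrable lebesgue S (\<lambda>x. \<bar>det (matrix (g' x))\<bar> *\<^sub>R f (g x))"
    and "(LINT x:g ` S|lebesgue. f x) = (LINT x:S|lebesgue. \<bar>det (matrix (g' x))\<bar> *\<^sub>R f (g x))"
proof -
  obtain \<tau> :: "'n ranked \<Rightarrow> 'n" where \<tau>: "bij \<tau>" using ex_bij_ranked by blast
  define \<sigma> where "\<sigma> = inv \<tau>"
  have \<sigma>: "bij \<sigma>" using \<tau> by (simp add: \<sigma>_def bij_imp_bij_inv)
  have inv [simp]: "\<sigma> (\<tau> i) = i" "\<tau> (\<sigma> j) = j" for i j
    using \<tau> by (auto simp: \<sigma>_def bij_is_inj surj_f_inv_f bij_is_surj)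
  define P where "P y = (\<chi> i. y $ \<sigma> i)" for y :: "real ^ 'n ranked"
  define Q where "Q x = (\<chi> j. x $ \<tau> j)" for x :: "real ^ 'n"
  have PQ [simp]: "P (Q x) = x" and QP [simp]: "Q (P y) = y" for x y
    by (simp_all add: P_def Q_def vec_eq_iff)
  have linP: "bounded_linear P" and linQ: "bounded_linear Q"
    unfolding linear_conv_bounded_linear[symmetric]
    by (auto intro!: linearI simp: P_def Q_def vec_eq_iff)
  have P: "P \<in> lebesgue \<rightarrow>\<^sub>M lebesgue" "distr lebesgue lebesgue P = lebesgue"
    using distr_lebesgue_eqI[OF borel_measurable_continuous_onI[OF linear_continuous_on[OF linP]]]
      distr_lborel_reindex[OF \<sigma>] by (simp_all add: P_def[abs_def])
  have Q: "Q \<in> lebesgue \<rightarrow>\<^sub>M lebesgue" "distr lebesgue lebesgue Q = lebesgue"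
    using distr_lebesgue_eqI[OF borel_measurable_continuous_onI[OF linear_continuous_on[OF linQ]]]
      distr_lborel_reindex[OF \<tau>] by (simp_all add: Q_def[abs_def])
  have vimP: "P -` X = Q ` X" and vimQ: "Q -` Y = P ` Y" for X Y
    by (auto simp: image_iff intro: bexI[of _ "P _"] bexI[of _ "Q _"]) (metis PQ QP)+
  define g2 where "g2 = Q \<circ> g \<circ> P"
  define g2' where "g2' y = Q \<circ> g' (P y) \<circ> P" for y
  let ?S = "P -` S"
  have S2: "?S \<in> sets lebesgue" using measurable_sets[OF P(1) S] by simp
  have img: "g2 ` ?S = P -` (g ` S)"
    by (auto simp: vimP g2_def image_image)
  have inj2: "inj_on g2 ?S"
    using inj unfolding inj_on_def g2_def by (metis PQ QP comp_apply vimage_eq)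
  have der2: "(g2 has_derivative g2' y) (at y within ?S)" if "y \<in> ?S" for y
    unfolding g2_def g2'_def
  proof (intro diff_chain_within)
    show "(P has_derivative P) (at y within ?S)" "(Q has_derivative Q) (at (g (P y)) within g ` P ` ?S)"
      using linP linQ by (auto intro: bounded_linear_imp_has_derivative)
    show "(g has_derivative g' (P y)) (at (P y) within P ` ?S)"
      using der[of "P y"] that by (auto intro: has_derivative_subset)
  qed
  have det2: "det (matrix (g2' y)) = det (matrix (g' (P y)))" for y
  proof -
    have Pax: "P (axis j 1) = axis (\<tau> j) 1" for j
      by (auto simp: P_def axis_def vec_eq_iff)
    have "matrix (g2' y) = (\<chi> i j. matrix (g' (P y)) $ \<tau> i $ \<tau> j)"
      by (subst vec_eq_iff) (simp add: matrix_def g2'_def Q_def Pax)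
    then show ?thesis using det_reindex[OF \<tau>] by metis
  qed
  have f2: "set_integrable lebesgue (g2 ` ?S) (\<lambda>y. f (P y))"
    unfolding img by (rule set_integral_vimage[OF P f])
  note cv = set_integral_change_of_variables_wellorder[OF S2 der2 inj2 f2]
  have gP: "P (g2 y) = g (P y)" for y by (simp add: g2_def)
  have QS: "Q -` ?S = S" by auto
  note cv' = cv[unfolded det2 gP]
  show "set_integrable lebesgue S (\<lambda>x. \<bar>det (matrix (g' x))\<bar> *\<^sub>R f (g x))"
    using set_integral_vimage(1)[OF Q cv'(1)] by (simp add: QS)
  show "(LINT x:g ` S|lebesgue. f x) = (LINT x:S|lebesgue. \<bar>det (matrix (g' x))\<bar> *\<^sub>R f (g x))"
    using set_integral_vimage(2)[OF Q cv'(1)] set_integral_vimage(2)[OF P f] cv'(2)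
    by (simp add: QS img)
qed

section \<open>Independence of the unit cell\<close>

lemma lebesgue_shift:
  fixes K :: "'a::euclidean_space"
  shows "(\<lambda>x. x + K) \<in> lebesgue \<rightarrow>\<^sub>M lebesgue" and "distr lebesgue lebesgue (\<lambda>x. x + K) = lebesgue"
proof -
  have "(+) K = (\<lambda>x. x + K)" by (auto simp: add.commute)
  then have "distr lborel borel (\<lambda>x. x + K) = lborel"
    using lborel_distr_plus[of K] by simp
  then show "(\<lambda>x. x + K) \<in> lebesgue \<rightarrow>\<^sub>M lebesgue" "distr lebesgue lebesgue (\<lambda>x. x + K) = lebesgue"
    using distr_lebesgue_eqI[of "\<lambda>x. x + K"] by simp_all
qed

lemma nn_integral_lebesgue_shift:
  fixes F :: "'a::euclidean_space \<Rightarrow> ennreal"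
  assumes "F \<in> borel_measurable lebesgue"
  shows "(\<integral>\<^sup>+x. F (x + K) \<partial>lebesgue) = (\<integral>\<^sup>+x. F x \<partial>lebesgue)"
  using nn_integral_distr[OF lebesgue_shift(1), of F K] assms lebesgue_shift(2)[of K] by simp

text \<open>With \<open>P K\<close> saying that \<open>x - K\<close> lies in a unit cell, this is
  the partition of unity by the translates of the cell: their indicators sum to 1 at almost every
  \<open>x\<close>.\<close>

lemma nn_integral_count_space_unique:
  assumes "\<exists>!K. K \<in> L \<and> P K"
  shows "(\<integral>\<^sup>+K. indicator {K. P K} K \<partial>count_space L) = 1"
proof -
  obtain K0 where K0: "K0 \<in> L" "P K0" "\<And>K. K \<in> L \<Longrightarrow> P K \<Longrightarrow> K = K0"
    using assms by blast
  have "(\<integral>\<^sup>+K. indicator {K. P K} K \<partial>count_space L) = (\<integral>\<^sup>+K. indicator {K0} K \<partial>count_space L)"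
  proof (rule nn_integral_cong_AE, rule AE_I2)
    fix K assume "K \<in> space (count_space L)"
    then have "P K \<longleftrightarrow> K = K0" using K0 by (metis space_count_space)
    then show "indicator {K. P K} K = (indicator {K0} K :: ennreal)"
      by (cases "K = K0") (simp_all only: indicator_simps mem_Collect_eq singleton_iff not_False_eq_True)
  qed
  also have "\<dots> = 1"
    using K0(1) by (subst nn_integral_indicator) auto
  finally show ?thesis .
qed

text \<open>Double unfolding: insert the factor 1 as the sum of the indicators of the translates of
  \<open>C\<close>, exchange sum and integral, translate each summand by \<open>K\<close>, and
  recognise the sum of the indicators of the translates of \<open>B\<close>. Nonnegativity and
  countability of \<open>L\<close> justify the exchange without any integrability assumption. The
  translation turns \<open>x - K\<close> into \<open>x + K\<close>, which is why \<open>L\<close>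
  has to be closed under negation.\<close>

lemma nn_integral_unit_cell_cong:
  fixes f :: "real ^ 'n \<Rightarrow> ennreal"
  assumes L: "countable L" "\<And>K. K \<in> L \<Longrightarrow> - K \<in> L"
    and cells: "unit_cell L B" "unit_cell L C"
    and f [measurable]: "f \<in> borel_measurable lebesgue"
    and per: "\<And>x K. K \<in> L \<Longrightarrow> f (x + K) = f x"
  shows "(\<integral>\<^sup>+x. f x * indicator B x \<partial>lebesgue) = (\<integral>\<^sup>+x. f x * indicator C x \<partial>lebesgue)"
proof -
  have [measurable]: "B \<in> sets lebesgue" "C \<in> sets lebesgue"
    and B: "AE x in lebesgue. \<exists>!K. K \<in> L \<and> x - K \<in> B"
    and C: "AE x in lebesgue. \<exists>!K. K \<in> L \<and> x - K \<in> C"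
    using cells by (auto simp: unit_cell_def)
  have shift [measurable]: "(\<lambda>x. x + K) \<in> lebesgue \<rightarrow>\<^sub>M lebesgue" for K :: "real ^ 'n"
    by (rule lebesgue_shift(1))
  have [measurable]: "(\<lambda>x. x - K) \<in> lebesgue \<rightarrow>\<^sub>M lebesgue" for K :: "real ^ 'n"
    using shift[of "- K"] by simp
  have "(\<integral>\<^sup>+x. f x * indicator B x \<partial>lebesgue)
      = (\<integral>\<^sup>+x. \<integral>\<^sup>+K. f x * indicator B x * indicator C (x - K) \<partial>count_space L \<partial>lebesgue)"
  proof (intro nn_integral_cong_AE)
    show "AE x in lebesgue. f x * indicator B x = (\<integral>\<^sup>+K. f x * indicator B x * indicator C (x - K) \<partial>count_space L)"
      using C
    proof eventually_elim
      case (elim x)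
      then show ?case
        using nn_integral_count_space_unique[OF elim]
        by (subst nn_integral_cmult) (auto simp: indicator_def)
    qed
  qed
  also have "\<dots> = (\<integral>\<^sup>+K. \<integral>\<^sup>+x. f x * indicator B x * indicator C (x - K) \<partial>lebesgue \<partial>count_space L)"
    using L(1) by (intro nn_integral_count_space_nn_integral) auto
  also have "\<dots> = (\<integral>\<^sup>+K. \<integral>\<^sup>+x. f x * indicator C x * indicator B (x + K) \<partial>lebesgue \<partial>count_space L)"
  proof -
    have "(\<integral>\<^sup>+x. f x * indicator B x * indicator C (x - K) \<partial>lebesgue)
        = (\<integral>\<^sup>+x. f x * indicator C x * indicator B (x + K) \<partial>lebesgue)" if "K \<in> L" for K
    proof -
      have "(\<integral>\<^sup>+x. f x * indicator B x * indicator C (x - K) \<partial>lebesgue)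
        = (\<integral>\<^sup>+x. f (x + K) * indicator B (x + K) * indicator C (x + K - K) \<partial>lebesgue)"
        by (rule nn_integral_lebesgue_shift[symmetric]) measurable
      then show ?thesis by (simp add: per[OF that] mult_ac)
    qed
    then show ?thesis by (subst nn_integral_cong) simp_all
  qed
  also have "\<dots> = (\<integral>\<^sup>+x. \<integral>\<^sup>+K. f x * indicator C x * indicator B (x + K) \<partial>count_space L \<partial>lebesgue)"
    using L(1) by (intro nn_integral_count_space_nn_integral[symmetric]) auto
  also have "\<dots> = (\<integral>\<^sup>+x. f x * indicator C x \<partial>lebesgue)"
  proof (intro nn_integral_cong_AE)
    show "AE x in lebesgue. (\<integral>\<^sup>+K. f x * indicator C x * indicator B (x + K) \<partial>count_space L) = f x * indicator C x"
      using B
    proof eventually_elim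
      case (elim x)
      then have "\<exists>!K. K \<in> L \<and> x + K \<in> B"
        by (metis L(2) add.inverse_inverse diff_minus_eq_add)
      from nn_integral_count_space_unique[OF this] show ?case
        by (subst nn_integral_cmult) (auto simp: indicator_def)
    qed
  qed
  finally show ?thesis .
qed

lemma set_integral_unit_cell_cong_real:
  fixes f :: "real ^ 'n \<Rightarrow> real"
  assumes L: "countable L" "\<And>K. K \<in> L \<Longrightarrow> - K \<in> L"
    and cells: "unit_cell L B" "unit_cell L C"
    and f [measurable]: "f \<in> borel_measurable lebesgue"
    and per: "\<And>x K. K \<in> L \<Longrightarrow> f (x + K) = f x"
    and int: "set_integrable lebesgue B f"
  shows "set_integrable lebesgue C f" and "(LINT x:C|lebesgue. f x) = (LINT x:B|lebesgue. f x)"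
proof -
  have [measurable]: "B \<in> sets lebesgue" "C \<in> sets lebesgue"
    using cells by (auto simp: unit_cell_def)
  \<comment> \<open>Since \<open>ennreal\<close> sends negative numbers to 0, the choices
    \<open>f\<close> and \<open>- f\<close> for \<open>h\<close> give the positive and the negative
    part of the integral; the absolute value of \<open>f\<close> gives integrability on
    \<open>C\<close>.\<close>
  have eq: "(\<integral>\<^sup>+x. ennreal (indicator C x *\<^sub>R h x) \<partial>lebesgue) = (\<integral>\<^sup>+x. ennreal (indicator B x *\<^sub>R h x) \<partial>lebesgue)"
    if [measurable]: "h \<in> borel_measurable lebesgue" and "\<And>x K. K \<in> L \<Longrightarrow> h (x + K) = h x" for h
  proof -
    have "ennreal (indicator X x *\<^sub>R h x) = ennreal (h x) * indicator X x" for X x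
      by (simp add: indicator_def)
    then show ?thesis
      using nn_integral_unit_cell_cong[OF L cells, of "\<lambda>x. ennreal (h x)"] that by simp
  qed
  have "(\<integral>\<^sup>+x. norm (indicator C x *\<^sub>R f x) \<partial>lebesgue) = (\<integral>\<^sup>+x. norm (indicator B x *\<^sub>R f x) \<partial>lebesgue)"
    using eq[of "\<lambda>x. \<bar>f x\<bar>"] per by (simp add: abs_mult)
  then show int': "set_integrable lebesgue C f"
    using int unfolding set_integrable_def integrable_iff_bounded by simp
  show "(LINT x:C|lebesgue. f x) = (LINT x:B|lebesgue. f x)"
    using int int' eq[of f] eq[of "\<lambda>x. - f x"] per
    unfolding set_integrable_def set_lebesgue_integral_def
    by (subst (1 2) real_lebesgue_integral_def) auto
qed

lemma integrable_complex_iff: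
  "integrable M f \<longleftrightarrow> integrable M (\<lambda>x. Re (f x)) \<and> integrable M (\<lambda>x. Im (f x))"
proof
  assume "integrable M (\<lambda>x. Re (f x)) \<and> integrable M (\<lambda>x. Im (f x))"
  then have "integrable M (\<lambda>x. of_real (Re (f x)) + \<i> * of_real (Im (f x)))" by simp
  then show "integrable M f" by (simp flip: complex_eq)
qed auto

lemma set_integral_unit_cell_cong:
  fixes f :: "real ^ 'n \<Rightarrow> complex"
  assumes L: "countable L" "\<And>K. K \<in> L \<Longrightarrow> - K \<in> L"
    and cells: "unit_cell L B" "unit_cell L C"
    and f [measurable]: "f \<in> borel_measurable lebesgue"
    and per: "\<And>x K. K \<in> L \<Longrightarrow> f (x + K) = f x"
    and int: "set_integrable lebesgue B f"
  shows "set_integrable lebesgue C f" and "(LINT x:C|lebesgue. f x) = (LINT x:B|lebesgue. f x)"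
proof -
  have int_iff: "set_integrable lebesgue X f \<longleftrightarrow>
      set_integrable lebesgue X (\<lambda>x. Re (f x)) \<and> set_integrable lebesgue X (\<lambda>x. Im (f x))" for X
    unfolding set_integrable_def by (subst integrable_complex_iff) simp
  note re = set_integral_unit_cell_cong_real[OF L cells, of "\<lambda>x. Re (f x)"]
  note im = set_integral_unit_cell_cong_real[OF L cells, of "\<lambda>x. Im (f x)"]
  show int': "set_integrable lebesgue C f"
    using re(1) im(1) per int by (simp add: int_iff)
  have "Re (LINT x:X|lebesgue. f x) = (LINT x:X|lebesgue. Re (f x))"
    "Im (LINT x:X|lebesgue. f x) = (LINT x:X|lebesgue. Im (f x))" if "set_integrable lebesgue X f" for X
    using that unfolding set_integrable_def set_lebesgue_integral_def
    by (simp_all add: integral_Re[symmetric] integral_Im[symmetric])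
  then show "(LINT x:C|lebesgue. f x) = (LINT x:B|lebesgue. f x)"
    using int int' re(2) im(2) per by (simp add: complex_eq_iff int_iff)
qed

section \<open>The fundamental parallelepiped\<close>

definition lattice_map :: "('n \<Rightarrow> real ^ 'n) \<Rightarrow> real ^ 'n \<Rightarrow> real ^ 'n"
  where "lattice_map b u = (\<Sum>i\<in>UNIV. u $ i *\<^sub>R b i)"

lemma linear_lattice_map: "linear (lattice_map b)"
  by (rule linearI) (auto simp: lattice_map_def scaleR_add_left sum.distrib scaleR_sum_right)

lemma continuous_on_lattice_map: "continuous_on S (lattice_map b)"
  using linear_lattice_map[of b] by (intro linear_continuous_on) (simp add: linear_conv_bounded_linear)

lemma bij_lattice_map:
  assumes "inj b" "independent (range b)"
  shows "bij (lattice_map b)"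
proof -
  have "u = 0" if "lattice_map b u = 0" for u
  proof -
    \<comment> \<open>Independence is a statement about coefficients attached to vectors, so the
      coordinates of \<open>u\<close> are reindexed from the index type to
      \<open>range b\<close>.\<close>
    have "(\<Sum>v\<in>range b. (u $ inv b v) *\<^sub>R v) = 0"
      using that assms(1) by (simp add: lattice_map_def sum.reindex)
    then have "\<forall>v\<in>range b. u $ inv b v = 0"
      using independentD[OF assms(2) finite_imageI[OF finite_class.finite_UNIV] subset_refl,
          of "\<lambda>v. u $ inv b v"] by auto
    then show ?thesis using assms(1) by (simp add: vec_eq_iff)
  qed
  then have "inj (lattice_map b)"
    by (simp add: linear_injective_0 linear_lattice_map)
  then show ?thesis
    using linear_injective_imp_surjective[OF linear_lattice_map] by (simp add: bij_def)
qed

text \<open>Half open, so that the integer translates tile the space without overlap and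
  representatives are unique at every point, not only almost everywhere.\<close>

definition half_open_cube :: "(real ^ 'n) set"
  where "half_open_cube = {u. \<forall>i. 0 \<le> u $ i \<and> u $ i < 1}"

lemma half_open_cube_borel: "half_open_cube \<in> sets borel"
  unfolding half_open_cube_def by measurable

locale lattice_basis =
  fixes b :: "'n::finite \<Rightarrow> real ^ 'n"
  assumes inj_b: "inj b" and indep_b: "independent (range b)"
begin

abbreviation A :: "real ^ 'n \<Rightarrow> real ^ 'n"
  where "A \<equiv> lattice_map b"

definition lattice :: "(real ^ 'n) set"
  where "lattice = range (\<lambda>c :: 'n \<Rightarrow> int. \<Sum>i\<in>UNIV. real_of_int (c i) *\<^sub>R b i)"

lemma bij_A: "bij A"
  by (simp add: bij_lattice_map inj_b indep_b)

lemma lattice_eq: "lattice = A ` {u. \<forall>i. u $ i \<in> \<int>}"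
proof -
  have "(\<Sum>i\<in>UNIV. real_of_int (c i) *\<^sub>R b i) = A (\<chi> i. of_int (c i))" for c
    by (simp add: lattice_map_def)
  then have "lattice = range (\<lambda>c :: 'n \<Rightarrow> int. A (\<chi> i. of_int (c i)))"
    by (simp add: lattice_def)
  moreover have "{u. \<forall>i. u $ i \<in> \<int>} = range (\<lambda>c :: 'n \<Rightarrow> int. (\<chi> i. real_of_int (c i)))"
  proof safe
    fix u :: "real ^ 'n" assume "\<forall>i. u $ i \<in> \<int>"
    then have "u = (\<chi> i. of_int \<lfloor>u $ i\<rfloor>)" by (auto simp: vec_eq_iff)
    then show "u \<in> range (\<lambda>c :: 'n \<Rightarrow> int. (\<chi> i. real_of_int (c i)))"
      by (rule image_eqI[where f = "\<lambda>c. \<chi> i. real_of_int (c i)"]) simp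
  qed simp
  ultimately show ?thesis by auto
qed

lemma countable_lattice: "countable lattice"
  unfolding lattice_def
proof (rule countable_image)
  have "range (vec_nth :: int ^ 'n \<Rightarrow> _) = UNIV"
    by (metis surjI vec_lambda_beta ext)
  then show "countable (UNIV :: ('n \<Rightarrow> int) set)"
    by (metis countable_image uncountable_def countableI_type)
qed

lemma uminus_lattice: "K \<in> lattice \<Longrightarrow> - K \<in> lattice"
  by (auto simp: lattice_eq linear_neg[OF linear_lattice_map, symmetric] intro!: imageI)

text \<open>In coordinates with respect to the basis, \<open>K\<close> is the vector of integer
  parts of \<open>x\<close>, and \<open>x - K\<close> is the vector of fractional parts.\<close>

lemma cell_unique: "\<exists>!K. K \<in> lattice \<and> x - K \<in> A ` half_open_cube"
proof -
  obtain u where u: "x = A u" using bij_A by (metis bij_pointE)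
  have inj: "A v = A w \<longleftrightarrow> v = w" for v w using bij_A by (simp add: bij_is_inj inj_eq)
  show ?thesis
  proof (rule ex1I[of _ "A (\<chi> i. of_int \<lfloor>u $ i\<rfloor>)"])
    show "A (\<chi> i. of_int \<lfloor>u $ i\<rfloor>) \<in> lattice \<and> x - A (\<chi> i. of_int \<lfloor>u $ i\<rfloor>) \<in> A ` half_open_cube"
      unfolding u linear_diff[OF linear_lattice_map, symmetric]
      by (auto simp: lattice_eq half_open_cube_def intro!: imageI) linarith+
  next
    fix K assume K: "K \<in> lattice \<and> x - K \<in> A ` half_open_cube"
    then obtain m w where m: "K = A m" "\<And>i. m $ i \<in> \<int>"
      and w: "x - K = A w" "w \<in> half_open_cube" by (auto simp: lattice_eq)
    have "u - m = w"
      using w m u by (simp add: linear_diff[OF linear_lattice_map, symmetric] inj)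
    have "m $ i = of_int \<lfloor>u $ i\<rfloor>" for i
    proof -
      obtain z where z: "m $ i = of_int z" using m(2) Ints_cases by metis
      have "0 \<le> u $ i - m $ i" "u $ i - m $ i < 1"
        using w(2) \<open>u - m = w\<close> by (auto simp: half_open_cube_def)
      then have "\<lfloor>u $ i\<rfloor> = z" using z by (intro floor_unique) linarith+
      then show ?thesis using z by simp
    qed
    then have "m = (\<chi> i. of_int \<lfloor>u $ i\<rfloor>)" by (simp add: vec_eq_iff)
    then show "K = A (\<chi> i. of_int \<lfloor>u $ i\<rfloor>)" using m by simp
  qed
qed

text \<open>Borel measurability is recorded because the cell is later pulled back along a map known
  only to be continuous, and such a preimage of a merely Lebesgue measurable set could fail to be
  measurable.\<close>

lemma cell_borel: "A ` half_open_cube \<in> sets borel"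
proof -
  obtain A' where A': "linear A'" "\<And>x. A' (A x) = x" "\<And>x. A (A' x) = x"
    using linear_injective_isomorphism[OF linear_lattice_map, of b] bij_A by (auto simp: bij_def)
  have "A ` half_open_cube = A' -` half_open_cube"
    using A' by (auto simp: image_iff) metis
  moreover have "A' \<in> borel_measurable borel"
    using A'(1) by (intro borel_measurable_continuous_onI linear_continuous_on)
      (simp add: linear_conv_bounded_linear)
  ultimately show ?thesis
    using measurable_sets[of A' borel borel, OF _ half_open_cube_borel] by auto
qed

lemma cell_lebesgue: "A ` half_open_cube \<in> sets lebesgue"
  using cell_borel by simp

text \<open>Because \<phi> commutes with lattice translations, the lattice vectors that bring
  \<open>\<phi> y\<close> into the image are exactly those that bring \<open>y\<close> into the
  parallelepiped.\<close>

lemma unit_cell_image: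
  assumes "bij \<phi>" "\<And>x K. K \<in> lattice \<Longrightarrow> \<phi> (x + K) = \<phi> x + K" "\<phi> ` (A ` half_open_cube) \<in> sets lebesgue"
  shows "unit_cell lattice (\<phi> ` (A ` half_open_cube))"
proof -
  have "\<exists>!K. K \<in> lattice \<and> x - K \<in> \<phi> ` (A ` half_open_cube)" for x
  proof -
    obtain y where y: "x = \<phi> y" using assms(1) by (metis bij_pointE)
    have "x - K = \<phi> (y - K)" if "K \<in> lattice" for K
      using assms(2)[OF that, of "y - K"] y by simp
    then have "K \<in> lattice \<and> x - K \<in> \<phi> ` (A ` half_open_cube) \<longleftrightarrow> K \<in> lattice \<and> y - K \<in> A ` half_open_cube" for K
      using bij_is_inj[OF assms(1)] by (metis inj_image_mem_iff)
    then show ?thesis using cell_unique[of y] by simp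
  qed
  then show ?thesis using assms(3) by (simp add: unit_cell_def)
qed

lemma unit_cell_parallelepiped: "unit_cell lattice (A ` half_open_cube)"
  using unit_cell_image[of id] cell_lebesgue by simp

text \<open>Every value is already taken on the closed parallelepiped, which is compact.\<close>

lemma periodic_bounded:
  assumes "continuous_on UNIV f" "\<And>x K. K \<in> lattice \<Longrightarrow> f (x + K) = f x"
  shows "bounded (range (f :: real ^ 'n \<Rightarrow> 'b::metric_space))"
proof -
  have "compact (A ` cbox 0 1)"
    by (intro compact_continuous_image continuous_on_lattice_map compact_cbox)
  then have "compact (f ` A ` cbox 0 1)"
    using assms(1) by (intro compact_continuous_image[where f = f]) (auto intro: continuous_on_subset)
  moreover have "range f \<subseteq> f ` A ` cbox 0 1"
  proof safe
    fix x
    obtain K u where "K \<in> lattice" "x - K = A u" "u \<in> half_open_cube" using cell_unique[of x] by blast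
    then have "f x = f (A u)" "u \<in> cbox 0 1"
      using assms(2) by (metis diff_add_cancel, auto simp: half_open_cube_def mem_box_cart less_imp_le)
    then show "f x \<in> f ` A ` cbox 0 1" by blast
  qed
  ultimately show ?thesis by (meson bounded_subset compact_imp_bounded)
qed

end

section \<open>Parametric integrals and real shifts\<close>

text \<open>The integral over a triangle is exchanged with the integral over the box; for each fixed
  \<open>u\<close> the inner triangle integral vanishes by Cauchy's theorem. Joint continuity on a
  compact box justifies the exchange, so no derivative in \<open>s\<close> has to be
  dominated.\<close>

lemma holomorphic_on_integral_param:
  fixes f :: "complex \<Rightarrow> 'a::euclidean_space \<Rightarrow> complex"
  assumes U: "open U"
    and cont: "continuous_on (U \<times> cbox a b) (\<lambda>(s, u). f s u)"
    and hol: "\<And>u. u \<in> cbox a b \<Longrightarrow> (\<lambda>s. f s u) holomorphic_on U"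
  shows "(\<lambda>s. integral (cbox a b) (f s)) holomorphic_on U"
proof (rule analytic_imp_holomorphic, rule Morera_triangle)
  let ?G = "\<lambda>s. integral (cbox a b) (f s)"
  show "continuous_on U ?G" by (rule integral_continuous_on_param[OF cont])
  show "open U" by fact
  fix p q r
  \<comment> \<open>One side of the triangle at a time: parametrised over \<open>[0, 1]\<close>, the
    double integral lives on a product box. Integrability is kept as a second conclusion so that the
    three sides can be added under the integral.\<close>
  have line: "contour_integral (linepath x y) ?G
        = integral (cbox a b) (\<lambda>u. contour_integral (linepath x y) (\<lambda>s. f s u))
      \<and> (\<lambda>u. contour_integral (linepath x y) (\<lambda>s. f s u)) integrable_on cbox a b"
    if sub: "closed_segment x y \<subseteq> U" for x y
  proof -
    have c: "continuous_on (cbox (0::real, a) (1, b)) (\<lambda>(t, u). f (linepath x y t) u * (y - x))"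
    proof -
      have U': "linepath x y t \<in> U" if "0 \<le> t" "t \<le> 1" for t
        using sub linepath_in_path[of t x y] that by auto
      have l: "continuous_on S (\<lambda>z. linepath x y (fst z))" for S :: "(real \<times> 'a) set"
        unfolding linepath_def by (intro continuous_intros)
      have "continuous_on (cbox (0::real, a) (1, b)) (\<lambda>z. (\<lambda>(s, u). f s u) (linepath x y (fst z), snd z))"
        by (intro continuous_on_compose2[OF cont] continuous_intros l) (auto simp: U' cbox_Pair_eq)
      then show ?thesis
        by (auto simp: case_prod_unfold intro!: continuous_intros)
    qed
    have c': "continuous_on (cbox a b \<times> cbox (0::real) 1) (\<lambda>(u, t). f (linepath x y t) u * (y - x))"
      using swap_continuous[OF c] by (simp add: cbox_Pair_eq)
    have "contour_integral (linepath x y) ?G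
        = integral (cbox 0 1) (\<lambda>t. integral (cbox a b) (\<lambda>u. f (linepath x y t) u * (y - x)))"
      by (simp add: contour_integral_integral)
    also have "\<dots> = integral (cbox a b) (\<lambda>u. integral (cbox 0 1) (\<lambda>t. f (linepath x y t) u * (y - x)))"
      by (rule integral_swap_continuous[OF c])
    finally show ?thesis
      using integrable_continuous[OF integral_continuous_on_param[OF c']]
      by (simp add: contour_integral_integral)
  qed
  show "convex hull {p, q, r} \<subseteq> U \<longrightarrow> contour_integral (linepath p q) ?G
      + contour_integral (linepath q r) ?G + contour_integral (linepath r p) ?G = 0"
  proof
    assume sub: "convex hull {p, q, r} \<subseteq> U"
    have seg: "closed_segment p q \<subseteq> U" "closed_segment q r \<subseteq> U" "closed_segment r p \<subseteq> U"
      by (rule order_trans[OF closed_segment_subset_convex_hull sub]; simp add: hull_inc)+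
    have zero: "contour_integral (linepath p q) (\<lambda>s. f s u) + contour_integral (linepath q r) (\<lambda>s. f s u)
        + contour_integral (linepath r p) (\<lambda>s. f s u) = 0" if "u \<in> cbox a b" for u
      using Cauchy_theorem_triangle[OF holomorphic_on_subset[OF hol[OF that] sub]]
      by (rule has_chain_integral_chain_integral3)
    have "contour_integral (linepath p q) ?G
        + contour_integral (linepath q r) ?G + contour_integral (linepath r p) ?G
      = integral (cbox a b) (\<lambda>u. contour_integral (linepath p q) (\<lambda>s. f s u)
          + contour_integral (linepath q r) (\<lambda>s. f s u) + contour_integral (linepath r p) (\<lambda>s. f s u))"
      using line[OF seg(1)] line[OF seg(2)] line[OF seg(3)]
      by (simp add: Henstock_Kurzweil_Integration.integral_add integrable_add)
    also have "\<dots> = 0" using zero by (simp cong: integral_cong)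
    finally show "contour_integral (linepath p q) ?G
        + contour_integral (linepath q r) ?G + contour_integral (linepath r p) ?G = 0" .
  qed
qed

text \<open>No matrix \<open>1 + t J\<close> with \<open>0 \<le> t \<le> 1\<close> has a kernel,
  since \<open>v = - t J v\<close> contradicts the contraction bound. The determinant thus keeps
  along this segment the sign it has at the identity. This is what drops the absolute value in the
  change of variables.\<close>

lemma det_id_plus_pos:
  fixes J :: "real ^ 'n ^ 'n"
  assumes J: "\<And>v. norm (J *v v) \<le> c * norm v" and c: "c < 1"
  shows "det (mat 1 + J) > 0"
proof (rule ccontr)
  assume neg: "\<not> det (mat 1 + J) > 0"
  let ?d = "\<lambda>t. det (mat 1 + t *\<^sub>R J)"
  have "continuous_on {0..1} ?d"
    by (auto simp: det_def intro!: continuous_intros)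
  moreover have "?d 1 \<le> 0" "0 \<le> ?d 0" using neg by auto
  ultimately obtain t where t: "0 \<le> t" "t \<le> 1" "?d t = 0"
    using IVT2'[of ?d 1 0 0] by auto
  then have "\<not> inj ((*v) (mat 1 + t *\<^sub>R J))"
    using det_nz_iff_inj[of "(*v) (mat 1 + t *\<^sub>R J)"] by simp
  then obtain v where v: "(mat 1 + t *\<^sub>R J) *v v = 0" "v \<noteq> 0"
    using linear_injective_0[of "(*v) (mat 1 + t *\<^sub>R J)"] by auto
  then have "v = - (t *\<^sub>R (J *v v))"
    by (simp add: matrix_vector_mult_add_rdistrib scaleR_matrix_vector_assoc eq_neg_iff_add_eq_0)
  then have "norm v = t * norm (J *v v)"
    using t(1) by (metis abs_of_nonneg norm_minus_cancel norm_scaleR)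
  also have "\<dots> \<le> 1 * norm (J *v v)" using t by (intro mult_right_mono) auto
  also have "\<dots> \<le> c * norm v" using J by simp
  also have "\<dots> < 1 * norm v" using c v(2) by (intro mult_strict_right_mono) auto
  finally show False by simp
qed

lemma continuously_differentiable_has_derivative:
  "continuously_differentiable h \<Longrightarrow> (h has_derivative (*v) (jacobian h (at k))) (at k)"
  by (simp add: continuously_differentiable_def flip: jacobian_works)

lemma jacobian_shift:
  assumes "continuously_differentiable h" "\<And>x. h (x + K) = h x"
  shows "jacobian h (at (k + K)) = jacobian h (at k)"
proof -
  let ?J = "\<lambda>k. jacobian h (at k)"
  have "(h \<circ> (\<lambda>x. x + K) has_derivative (*v) (?J (k + K)) \<circ> (\<lambda>v. v)) (at k)"
  proof (rule diff_chain_at)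
    show "((\<lambda>x. x + K) has_derivative (\<lambda>v. v)) (at k)"
      by (auto intro!: derivative_eq_intros)
  qed (rule continuously_differentiable_has_derivative[OF assms(1)])
  moreover have "h \<circ> (\<lambda>x. x + K) = h" using assms(2) by auto
  moreover have "(*v) (?J (k + K)) \<circ> (\<lambda>v. v) = (*v) (?J (k + K))" by auto
  ultimately have "(h has_derivative (*v) (?J (k + K))) (at k)" by metis
  then have "(*v) (?J (k + K)) = (*v) (?J k)"
    by (rule has_derivative_unique) (rule continuously_differentiable_has_derivative[OF assms(1)])
  then show ?thesis by (metis matrix_of_matrix_vector_mul)
qed

context lattice_basis
begin

text \<open>The bridge from Lebesgue integrals over the half-open cell to integrals over the closed
  unit cube, where the parametric lemmas apply. The faces that separate the two cubes are
  negligible.\<close>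

lemma set_integral_parallelepiped:
  fixes F :: "real ^ 'n \<Rightarrow> complex"
  assumes F: "continuous_on UNIV F"
  shows "set_integrable lebesgue (A ` half_open_cube) F"
    and "(LINT x:A ` half_open_cube|lebesgue. F x) = \<bar>det (matrix A)\<bar> *\<^sub>R integral (cbox 0 1) (\<lambda>u. F (A u))"
proof -
  have sub: "half_open_cube \<subseteq> cbox (0 :: real ^ 'n) 1"
    by (auto simp: half_open_cube_def mem_box_cart less_imp_le)
  have "compact (A ` cbox 0 1)" by (intro compact_continuous_image continuous_on_lattice_map compact_cbox)
  then have "set_integrable lborel (A ` cbox 0 1) F"
    unfolding set_integrable_def
    by (rule borel_integrable_compact) (rule continuous_on_subset[OF F], simp)
  then have "set_integrable lebesgue (A ` cbox 0 1) F"
    unfolding set_integrable_def by (metis borel_measurable_integrable integrable_completion)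
  then show int: "set_integrable lebesgue (A ` half_open_cube) F"
    using cell_lebesgue sub by (rule set_integrable_subset[OF _ _ image_mono])
  have meas: "(half_open_cube :: (real ^ 'n) set) \<in> sets lebesgue"
    by (rule sets_completionI_sets) (simp add: half_open_cube_borel)
  have der: "(A has_derivative A) (at x within half_open_cube)" for x
    by (simp add: linear_lattice_map linear_imp_has_derivative)
  have inj: "inj_on A half_open_cube" using bij_A by (meson bij_is_inj inj_on_subset subset_UNIV)
  note cv = set_integral_change_of_variables[OF meas der inj int]
  have "box 0 1 \<subseteq> (half_open_cube :: (real ^ 'n) set)"
    by (auto simp: half_open_cube_def mem_box_cart less_imp_le)
  then have "negligible (cbox 0 1 - half_open_cube :: (real ^ 'n) set)"
    by (intro negligible_subset[OF negligible_frontier_interval[of 0 1]]) auto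
  then have spike: "integral half_open_cube H = integral (cbox 0 1) H" for H :: "real ^ 'n \<Rightarrow> complex"
    by (rule integral_subset_negligible[OF sub])
  show "(LINT x:A ` half_open_cube|lebesgue. F x) = \<bar>det (matrix A)\<bar> *\<^sub>R integral (cbox 0 1) (\<lambda>u. F (A u))"
    unfolding cv(2) set_lebesgue_integral_eq_integral(2)[OF cv(1)] spike by simp
qed

lemma integral_real_shift:
  fixes F :: "real ^ 'n \<Rightarrow> complex" and h :: "real ^ 'n \<Rightarrow> real ^ 'n"
  assumes F: "continuous_on UNIV F" "\<And>x K. K \<in> lattice \<Longrightarrow> F (x + K) = F x"
    and h: "continuously_differentiable h" "\<And>x K. K \<in> lattice \<Longrightarrow> h (x + K) = h x"
  shows "\<exists>\<delta>>0. \<forall>s. \<bar>s\<bar> < \<delta> \<longrightarrow>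
       integral (cbox 0 1) (\<lambda>u. det (mat 1 + s *\<^sub>R jacobian h (at (A u))) *\<^sub>R F (A u + s *\<^sub>R h (A u)))
       = integral (cbox 0 1) (\<lambda>u. F (A u))"
proof -
  let ?J = "\<lambda>k. jacobian h (at k)"
  note derh = continuously_differentiable_has_derivative[OF h(1)]
  have conth: "continuous_on UNIV h"
    by (intro continuous_at_imp_continuous_on ballI has_derivative_continuous[OF derh])
  have contJ: "continuous_on UNIV ?J" using h(1) by (simp add: continuously_differentiable_def)
  have perJ: "?J (k + K) = ?J k" if "K \<in> lattice" for k K
    using h(1) h(2)[OF that] by (rule jacobian_shift)
  obtain b0 where b0: "\<And>k. norm (?J k) \<le> b0"
    using periodic_bounded[OF contJ perJ] by (auto simp: bounded_iff)
  \<comment> \<open>The operator norm is at most the number of matrix entries times a bound for each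
    entry; the added 1 makes \<open>M\<close> positive, so that \<open>1 / M\<close> is a valid
    threshold.\<close>
  define M where "M = real CARD('n) * real CARD('n) * b0 + 1"
  have "0 \<le> b0" using b0 norm_ge_zero order_trans by blast
  then have M: "M > 0" by (simp add: M_def add_nonneg_pos)
  have onorm_J: "onorm ((*v) (?J k)) \<le> M" for k
  proof -
    have "\<bar>?J k $ i $ j\<bar> \<le> b0" for i j
      using b0[of k] component_le_norm_cart[of "?J k $ i" j] Finite_Cartesian_Product.norm_nth_le[of "?J k" i] by linarith
    from onorm_le_matrix_component[OF this] show ?thesis by (simp add: M_def)
  qed
  have Jle: "norm (?J k *v v) \<le> M * norm v" for k v
    by (rule order_trans[OF Operator_Norm.onorm[OF matrix_vector_mul_bounded_linear]])
      (intro mult_right_mono onorm_J norm_ge_zero)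
  have lip: "norm (h x - h y) \<le> M * norm (x - y)" for x y
    by (rule differentiable_bound[OF convex_UNIV derh onorm_J UNIV_I UNIV_I])
  show ?thesis
  proof (intro exI conjI allI impI)
    show "1 / M > 0" using M by simp
    fix s :: real assume "\<bar>s\<bar> < 1 / M"
    then have c: "0 \<le> \<bar>s\<bar> * M" "\<bar>s\<bar> * M < 1" using M by (auto simp: field_simps)
    define \<phi> where "\<phi> x = x + s *\<^sub>R h x" for x
    \<comment> \<open>Solving \<open>\<phi> x = y\<close> means finding a fixed point of
      \<open>x \<mapsto> y - s h(x)\<close>, a contraction with constant \<open>|s| M < 1\<close>;
      Banach's theorem gives existence and uniqueness together.\<close>
    have bij: "bij \<phi>"
      unfolding bij_iff
    proof
      fix y
      have "\<forall>x x'. dist (y - s *\<^sub>R h x) (y - s *\<^sub>R h x') \<le> \<bar>s\<bar> * M * dist x x'"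
      proof (intro allI)
        fix x x'
        have "dist (y - s *\<^sub>R h x) (y - s *\<^sub>R h x') = \<bar>s\<bar> * norm (h x' - h x)"
          by (simp add: dist_norm flip: scaleR_diff_right)
        also have "\<dots> \<le> \<bar>s\<bar> * (M * norm (x' - x))"
          using lip by (intro mult_left_mono) auto
        finally show "dist (y - s *\<^sub>R h x) (y - s *\<^sub>R h x') \<le> \<bar>s\<bar> * M * dist x x'"
          by (simp add: dist_norm norm_minus_commute mult.assoc)
      qed
      moreover have "\<phi> x = y \<longleftrightarrow> y - s *\<^sub>R h x = x" for x
        by (auto simp: \<phi>_def algebra_simps)
      ultimately show "\<exists>!x. \<phi> x = y"
        using banach_fix_type[OF c, of "\<lambda>x. y - s *\<^sub>R h x"] by simp
    qed
    have cont\<phi>: "continuous_on UNIV \<phi>"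
      unfolding \<phi>_def by (intro continuous_intros conth)
    have der\<phi>: "(\<phi> has_derivative (*v) (mat 1 + s *\<^sub>R ?J k)) (at k)" for k
      unfolding \<phi>_def
      by (auto intro!: derivative_eq_intros derh
          simp: matrix_vector_mult_add_rdistrib scaleR_matrix_vector_assoc)
    have det: "\<bar>det (matrix ((*v) (mat 1 + s *\<^sub>R ?J k)))\<bar> = det (mat 1 + s *\<^sub>R ?J k)" for k
    proof -
      have "norm ((s *\<^sub>R ?J k) *v v) \<le> \<bar>s\<bar> * M * norm v" for v
        using mult_left_mono[OF Jle[of k v], of "\<bar>s\<bar>"] by (simp add: scaleR_matrix_vector_assoc[symmetric] mult.assoc)
      from det_id_plus_pos[OF this c(2)] show ?thesis by (simp add: matrix_of_matrix_vector_mul)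
    qed
    let ?C = "A ` half_open_cube"
    \<comment> \<open>By invariance of domain \<phi> is open, so its inverse \<psi> is continuous
      and the image of the Borel cell under \<phi> is the Borel preimage under \<psi>.\<close>
    have meas: "\<phi> ` ?C \<in> sets lebesgue"
    proof -
      obtain \<psi> where \<psi>: "\<And>x. \<psi> (\<phi> x) = x" "\<And>y. \<phi> (\<psi> y) = y"
        using bij by (metis bij_is_inj bij_is_surj inv_f_f surj_f_inv_f)
      have vim: "\<psi> -` S = \<phi> ` S" for S using \<psi> by (auto simp: image_iff) metis
      have "open (\<phi> ` S)" if "open S" for S
        using invariance_of_domain[of S \<phi>] that bij cont\<phi>
        by (meson bij_is_inj continuous_on_subset inj_on_subset subset_UNIV)
      then have "continuous_on UNIV \<psi>"
        by (simp add: continuous_on_open_vimage vim)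
      then have "\<psi> \<in> borel_measurable borel" by (rule borel_measurable_continuous_onI)
      then have "\<phi> ` ?C \<in> sets borel"
        using measurable_sets[of \<psi> borel borel ?C] cell_borel by (simp add: vim)
      then show ?thesis by simp
    qed
    have cell: "unit_cell lattice (\<phi> ` ?C)"
      using bij meas by (intro unit_cell_image) (auto simp: \<phi>_def h(2))
    have Fmeas: "F \<in> borel_measurable lebesgue"
      using borel_measurable_continuous_onI[OF F(1)] by (simp add: measurable_completion)
    \<comment> \<open>Periodicity of \<open>F\<close> equates its integrals over the cell and over
      the image of the cell; the change of variables that follows pulls the latter back to the
      original cell.\<close>
    note cong = set_integral_unit_cell_cong[OF countable_lattice uminus_lattice unit_cell_parallelepiped cell
        Fmeas F(2) set_integral_parallelepiped(1)[OF F(1)]]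
    note cv = set_integral_change_of_variables(2)[OF cell_lebesgue
        has_derivative_at_withinI[OF der\<phi>] inj_on_subset[OF bij_is_inj[OF bij] subset_UNIV] cong(1),
        unfolded det]
    let ?H = "\<lambda>k. det (mat 1 + s *\<^sub>R ?J k) *\<^sub>R F (k + s *\<^sub>R h k)"
    have "continuous_on UNIV ?H"
      unfolding det_def using contJ
      by (auto intro!: continuous_intros continuous_on_compose2[OF F(1)] conth)
    note H = set_integral_parallelepiped(2)[OF this]
    have "det (matrix A) \<noteq> 0"
      using det_nz_iff_inj[OF linear_lattice_map, of b] bij_A by (simp add: bij_is_inj)
    moreover have "\<bar>det (matrix A)\<bar> *\<^sub>R integral (cbox 0 1) (\<lambda>u. ?H (A u))
        = \<bar>det (matrix A)\<bar> *\<^sub>R integral (cbox 0 1) (\<lambda>u. F (A u))"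
      using cv cong(2) set_integral_parallelepiped(2)[OF F(1)] H by (simp add: \<phi>_def)
    ultimately show "integral (cbox 0 1) (\<lambda>u. ?H (A u)) = integral (cbox 0 1) (\<lambda>u. F (A u))"
      by simp
  qed
qed

end

section \<open>The deformed integrand\<close>

definition complex_translate :: "(real ^ 'n \<Rightarrow> real ^ 'n) \<Rightarrow> complex \<Rightarrow> real ^ 'n \<Rightarrow> complex ^ 'n"
  where "complex_translate h s k = complexify k + s *s complexify (h k)"

text \<open>The value at \<open>\<i>\<close> is the integrand of the theorem, the value at 0 is the
  undeformed one. Writing the determinant through the real Jacobian of \<open>h\<close> makes it
  visibly a polynomial in \<open>s\<close>.\<close>

definition deformed_integrand ::
    "(complex ^ 'n \<Rightarrow> complex) \<Rightarrow> (real ^ 'n \<Rightarrow> real ^ 'n) \<Rightarrow> complex \<Rightarrow> real ^ 'n \<Rightarrow> complex"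
  where "deformed_integrand I h s k = I (complex_translate h s k) *
    det (mat 1 + (\<chi> i j. s * complex_of_real (jacobian h (at k) $ i $ j)))"

lemma complexify_add: "complexify (x + y) = complexify x + complexify y"
  by (simp add: complexify_def vec_eq_iff)

text \<open>The real part of \<open>s\<close> only moves the point along the real directions, in
  which the tube is unbounded; the imaginary part scales \<open>h\<close> by a factor of modulus at
  most 1.\<close>

lemma complex_translate_in_tube:
  assumes h: "\<And>i. h k $ i \<in> {- \<eta>..\<eta>}" and s: "\<bar>Im s\<bar> \<le> 1"
  shows "complex_translate h s k \<in> tube \<eta>"
proof -
  have "complex_translate h s k = complexify (k + Re s *\<^sub>R h k) + \<i> *s complexify (Im s *\<^sub>R h k)"
    by (simp add: complex_translate_def complexify_def vec_eq_iff complex_eq_iff)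
  moreover have "(Im s *\<^sub>R h k) $ i \<in> {- \<eta>..\<eta>}" for i
  proof -
    have "\<bar>Im s * h k $ i\<bar> \<le> 1 * \<eta>"
      unfolding abs_mult using h[of i] s by (intro mult_mono) auto
    then show ?thesis by auto
  qed
  ultimately show ?thesis unfolding tube_def by blast
qed

text \<open>The strip is closed here because continuity up to its boundary is what later reaches
  \<open>\<i>\<close>.\<close>

lemma continuous_on_deformed_integrand:
  assumes I: "continuous_on (tube \<eta>) I"
    and h: "continuously_differentiable h" "\<And>k i. h k $ i \<in> {- \<eta>..\<eta>}"
  shows "continuous_on ({s. \<bar>Im s\<bar> \<le> 1} \<times> UNIV) (\<lambda>(s, k). deformed_integrand I h s k)"
proof -
  let ?S = "{s. \<bar>Im s\<bar> \<le> 1} \<times> (UNIV :: (real ^ 'a) set)"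
  have "continuous_on UNIV h"
    by (intro continuous_at_imp_continuous_on ballI
        has_derivative_continuous[OF continuously_differentiable_has_derivative[OF h(1)]])
  then have conth: "continuous_on ?S (\<lambda>z. h (snd z))"
    by (rule continuous_on_compose2) (auto intro!: continuous_intros)
  have "continuous_on UNIV (\<lambda>k. jacobian h (at k))"
    using h(1) by (simp add: continuously_differentiable_def)
  then have contJ: "continuous_on ?S (\<lambda>z. jacobian h (at (snd z)))"
    by (rule continuous_on_compose2) (auto intro!: continuous_intros)
  have "continuous_on ?S (\<lambda>z. complex_translate h (fst z) (snd z))"
    unfolding complex_translate_def complexify_def vector_scalar_mult_def
    by (intro continuous_intros conth | simp)+
  then have "continuous_on ?S (\<lambda>z. I (complex_translate h (fst z) (snd z)))"
    by (rule continuous_on_compose2[OF I]) (use h(2) in \<open>auto intro!: complex_translate_in_tube\<close>)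
  moreover have "continuous_on ?S
      (\<lambda>z. det (mat 1 + (\<chi> i j. fst z * complex_of_real (jacobian h (at (snd z)) $ i $ j))))"
    unfolding det_def by (intro continuous_intros contJ | simp)+
  ultimately show ?thesis
    unfolding deformed_integrand_def case_prod_unfold by (rule continuous_on_mult)
qed

text \<open>Chain rule along a complex line: complex linearity of \<open>D\<close> turns the real
  derivative \<open>t \<mapsto> D (t w)\<close> into multiplication by the number
  \<open>D w\<close>.\<close>

lemma holomorphic_several_on_line:
  assumes I: "holomorphic_several_on I W" and s: "c + s *s w \<in> W"
  shows "(\<lambda>t. I (c + t *s w)) field_differentiable at s"
proof -
  obtain D where D: "(I has_derivative D) (at (c + s *s w))" "Vector_Spaces.linear (*s) (*) D"
    using I s by (auto simp: holomorphic_several_on_def)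
  have "linear (\<lambda>t. t *s w)"
    by (rule linearI) (auto simp: vec_eq_iff algebra_simps)
  then have "((\<lambda>t. t *s w) has_derivative (\<lambda>t. t *s w)) (at s)"
    by (rule linear_imp_has_derivative)
  then have "((\<lambda>t. c + t *s w) has_derivative (\<lambda>t. t *s w)) (at s)"
    by (auto intro!: derivative_eq_intros)
  from diff_chain_at[OF this D(1)]
  have "((\<lambda>t. I (c + t *s w)) has_derivative (\<lambda>t. D (t *s w))) (at s)"
    by (simp add: o_def)
  moreover have "D (t *s w) = D w * t" for t
    using D(2) by (simp add: Vector_Spaces.linear_def module_hom_def module_hom_axioms_def mult.commute)
  ultimately have "((\<lambda>t. I (c + t *s w)) has_field_derivative D w) (at s)"
    by (simp add: has_field_derivative_def)
  then show ?thesis by (auto simp: field_differentiable_def)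
qed

text \<open>For fixed \<open>k\<close>, \<open>I\<close> is evaluated along the complex line with
  direction \<open>h k\<close>, and the determinant is a polynomial in \<open>s\<close>.\<close>

lemma holomorphic_on_deformed_integrand:
  assumes I: "holomorphic_several_on I W" "tube \<eta> \<subseteq> W"
    and h: "\<And>i. h k $ i \<in> {- \<eta>..\<eta>}"
  shows "(\<lambda>s. deformed_integrand I h s k) holomorphic_on {s. \<bar>Im s\<bar> < 1}"
  unfolding deformed_integrand_def
proof (rule holomorphic_on_mult)
  show "(\<lambda>s. I (complex_translate h s k)) holomorphic_on {s. \<bar>Im s\<bar> < 1}"
    unfolding holomorphic_on_def
  proof
    fix s assume "s \<in> {s. \<bar>Im s\<bar> < 1}"
    then have "complex_translate h s k \<in> W"
      using complex_translate_in_tube[of h k \<eta> s, OF h] I(2) by auto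
    then have "(\<lambda>s. I (complex_translate h s k)) field_differentiable at s"
      unfolding complex_translate_def by (rule holomorphic_several_on_line[OF I(1)])
    then show "(\<lambda>s. I (complex_translate h s k)) field_differentiable at s within {s. \<bar>Im s\<bar> < 1}"
      by (rule field_differentiable_at_within)
  qed
  show "(\<lambda>s. det (mat 1 + (\<chi> i j. s * complex_of_real (jacobian h (at k) $ i $ j)))) holomorphic_on {s. \<bar>Im s\<bar> < 1}"
    unfolding det_def vector_add_component vec_lambda_beta by (intro holomorphic_intros)
qed

lemma deformed_integrand_of_real:
  "deformed_integrand I h (of_real s) k =
     det (mat 1 + s *\<^sub>R jacobian h (at k)) *\<^sub>R I (complexify (k + s *\<^sub>R h k))"
proof -
  have "complex_translate h (of_real s) k = complexify (k + s *\<^sub>R h k)"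
    by (simp add: complex_translate_def complexify_def vec_eq_iff)
  moreover have "det (mat 1 + (\<chi> i j. of_real s * complex_of_real (jacobian h (at k) $ i $ j)))
      = of_real (det (mat 1 + s *\<^sub>R jacobian h (at k)))"
    by (simp add: det_def mat_def if_distrib[of of_real] cong: if_cong)
  ultimately show ?thesis
    by (simp add: deformed_integrand_def scaleR_conv_of_real mult.commute)
qed

lemma complex_jacobian_shift:
  assumes h: "continuously_differentiable h"
    and kappa: "\<And>k. \<kappa> k = complexify k + \<i> *s complexify (h k)"
  shows "complex_jacobian \<kappa> k = mat 1 + (\<chi> i j. \<i> * complex_of_real (jacobian h (at k) $ i $ j))"
proof -
  have lin: "linear (complexify :: real ^ 'a \<Rightarrow> _)" "linear (\<lambda>v :: complex ^ 'a. \<i> *s v)"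
    by (auto intro!: linearI simp: complexify_def vec_eq_iff complex_eq_iff algebra_simps)
  have "((\<lambda>k. complexify (h k)) has_derivative (\<lambda>v. complexify (jacobian h (at k) *v v))) (at k)"
    using diff_chain_at[OF continuously_differentiable_has_derivative[OF h] linear_imp_has_derivative[OF lin(1)]]
    by (simp add: o_def)
  then have "((\<lambda>k. \<i> *s complexify (h k)) has_derivative (\<lambda>v. \<i> *s complexify (jacobian h (at k) *v v))) (at k)"
    using diff_chain_at[OF _ linear_imp_has_derivative[OF lin(2)]] by (fastforce simp: o_def)
  then have "(\<kappa> has_derivative (\<lambda>v. complexify v + \<i> *s complexify (jacobian h (at k) *v v))) (at k)"
    unfolding kappa[abs_def] by (intro has_derivative_add linear_imp_has_derivative lin(1))
  from frechet_derivative_at[OF this]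
  have fd: "frechet_derivative \<kappa> (at k) v = complexify v + \<i> *s complexify (jacobian h (at k) *v v)" for v
    by metis
  have "(jacobian h (at k) *v axis j 1) $ i = jacobian h (at k) $ i $ j" for i j
    by (simp add: matrix_vector_mult_basis column_def)
  then have "complex_jacobian \<kappa> k $ i $ j =
      of_real (axis j 1 $ i) + \<i> * of_real (jacobian h (at k) $ i $ j)" for i j
    by (simp add: complex_jacobian_def fd complexify_def)
  then show ?thesis
    by (auto simp: vec_eq_iff axis_def mat_def)
qed

lemma (in lattice_basis) integral_deformed_integrand:
  assumes I: "holomorphic_several_on I W" "tube \<eta> \<subseteq> W" "continuous_on (tube \<eta>) I"
    and h: "continuously_differentiable h" "\<And>k i. h k $ i \<in> {- \<eta>..\<eta>}"
    and perI: "\<And>x K. K \<in> lattice \<Longrightarrow> I (complexify (x + K)) = I (complexify x)"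
    and contI: "continuous_on UNIV (\<lambda>x. I (complexify x))"
    and perh: "\<And>x K. K \<in> lattice \<Longrightarrow> h (x + K) = h x"
  shows "integral (cbox 0 1) (\<lambda>u. deformed_integrand I h \<i> (A u)) = integral (cbox 0 1) (\<lambda>u. I (complexify (A u)))"
proof -
  let ?U = "{s. \<bar>Im s\<bar> < 1}"
  let ?S = "{s. \<bar>Im s\<bar> \<le> 1}"
  let ?c = "integral (cbox 0 1) (\<lambda>u. I (complexify (A u)))"
  define G where "G s = integral (cbox 0 1) (\<lambda>u. deformed_integrand I h s (A u))" for s
  have "continuous_on (?S \<times> cbox 0 1) (\<lambda>z. (\<lambda>(s, k). deformed_integrand I h s k) (fst z, A (snd z)))"
    by (intro continuous_on_compose2[OF continuous_on_deformed_integrand[OF I(3) h]]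
        continuous_intros continuous_on_compose2[OF continuous_on_lattice_map]) auto
  then have cont: "continuous_on (?S \<times> cbox 0 1) (\<lambda>(s, u). deformed_integrand I h s (A u))"
    by (simp add: case_prod_unfold)
  have contG: "continuous_on ?S G"
    unfolding G_def by (rule integral_continuous_on_param[OF cont])
  have strip: "?U = {s. Im s > - 1} \<inter> {s. Im s < 1}" by auto
  have "open ?U" unfolding strip by (intro open_Int open_halfspace_Im_gt open_halfspace_Im_lt)
  have "connected ?U"
    unfolding strip by (intro convex_connected convex_Int convex_halfspace_Im_gt convex_halfspace_Im_lt)
  have holG: "G holomorphic_on ?U"
    unfolding G_def
  proof (rule holomorphic_on_integral_param[OF \<open>open ?U\<close>])
    show "continuous_on (?U \<times> cbox 0 1) (\<lambda>(s, u). deformed_integrand I h s (A u))"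
      by (rule continuous_on_subset[OF cont]) auto
    show "(\<lambda>s. deformed_integrand I h s (A u)) holomorphic_on ?U" for u
      using I(1,2) h(2) by (rule holomorphic_on_deformed_integrand)
  qed
  obtain \<delta> where \<delta>: "\<delta> > 0" "\<And>s. \<bar>s\<bar> < \<delta> \<Longrightarrow> G (of_real s) = ?c"
    unfolding G_def deformed_integrand_of_real
    using integral_real_shift[OF contI perI h(1) perh] by blast
  \<comment> \<open>The identity theorem asks for an accumulation point inside the strip; 0 is one
    for this real interval.\<close>
  let ?R = "complex_of_real ` {- \<delta><..<\<delta>}"
  have "0 islimpt ?R"
    unfolding islimpt_approachable
  proof (intro allI impI)
    fix e :: real assume "e > 0"
    \<comment> \<open>Half the minimum is positive and strictly below both \<delta> and
      \<open>e\<close>.\<close>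
    then have mem: "min \<delta> e / 2 \<in> {- \<delta><..<\<delta>}" using \<delta>(1) by auto
    show "\<exists>x'\<in>?R. x' \<noteq> 0 \<and> dist x' 0 < e"
    proof (rule bexI[OF _ imageI[OF mem]])
      show "complex_of_real (min \<delta> e / 2) \<noteq> 0 \<and> dist (complex_of_real (min \<delta> e / 2)) 0 < e"
        using \<delta>(1) \<open>e > 0\<close> by (auto simp: min_def norm_divide)
    qed
  qed
  moreover have "?R \<subseteq> ?U" "0 \<in> ?U" by auto
  moreover have "(\<lambda>s. G s - ?c) holomorphic_on ?U" using holG by (intro holomorphic_intros)
  moreover have "G z - ?c = 0" if "z \<in> ?R" for z using that \<delta>(2)[of "Re z"] by auto
  ultimately have "G s - ?c = 0" if "s \<in> ?U" for s
    using that \<open>open ?U\<close> \<open>connected ?U\<close> by (intro analytic_continuation[of "\<lambda>s. G s - ?c" ?U ?R 0 s])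
  then have G_inside: "G s = ?c" if "\<bar>Im s\<bar> < 1" for s using that by simp
  \<comment> \<open>Along the segment from 0 to \<open>\<i>\<close> all points but the last lie in
    the open strip, so constancy on \<open>{0..<1}\<close> extends to the endpoint by
    continuity.\<close>
  have "continuous_on {0..1} (\<lambda>t. G (\<i> * of_real t))"
    by (rule continuous_on_compose2[OF contG]) (auto intro!: continuous_intros)
  then have "G (\<i> * of_real 1) = ?c"
    by (intro continuous_constant_on_closure[of "{0..<1}" "\<lambda>t. G (\<i> * of_real t)" ?c 1])
      (auto simp: G_inside closure_atLeastLessThan)
  then show ?thesis by (simp add: G_def)
qed

theorem lemma1:
  fixes L B :: "(real ^ 'n) set"
    and \<eta> :: real
    and I :: "complex ^ 'n \<Rightarrow> complex"
    and W :: "(complex ^ 'n) set"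
    and h :: "real ^ 'n \<Rightarrow> real ^ 'n"
    and \<kappa> :: "real ^ 'n \<Rightarrow> complex ^ 'n"
  assumes lattice: "full_rank_lattice L"
    and cell: "unit_cell L B"
    and eta: "\<eta> > 0"
    and W: "open W" "tube \<eta> \<subseteq> W"
    and I_holomorphic: "holomorphic_several_on I W"
    and I_periodic: "\<And>k K. k \<in> tube \<eta> \<Longrightarrow> K \<in> L \<Longrightarrow> I (k + complexify K) = I k"
    and h_range: "\<And>k i. h k $ i \<in> {- \<eta>..\<eta>}"
    and h_C1: "continuously_differentiable h"
    and h_periodic: "\<And>k K. K \<in> L \<Longrightarrow> h (k + K) = h k"
    and kappa: "\<And>k. \<kappa> k = complexify k + \<i> *s complexify (h k)"
  shows "set_integrable lebesgue B (\<lambda>k. I (complexify k)) \<and>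
         set_integrable lebesgue B (\<lambda>k. I (\<kappa> k) * det (complex_jacobian \<kappa> k)) \<and>
         (LINT k:B|lebesgue. I (complexify k)) =
         (LINT k:B|lebesgue. I (\<kappa> k) * det (complex_jacobian \<kappa> k)) \<and>
         (LINT k:B|lebesgue. I (\<kappa> k) * det (complex_jacobian \<kappa> k)) =
         (LINT k:B|lebesgue. I (complexify k + \<i> *s complexify (h k)) *
            det (mat 1 + (\<chi> i j. \<i> * complex_of_real (jacobian h (at k) $ i $ j))))"
proof -
  obtain b :: "'n \<Rightarrow> real ^ 'n" where b: "inj b" "independent (range b)"
    and L: "L = range (\<lambda>c :: 'n \<Rightarrow> int. \<Sum>i\<in>UNIV. real_of_int (c i) *\<^sub>R b i)"
    using lattice by (auto simp: full_rank_lattice_def)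
  interpret lattice_basis b by unfold_locales (fact b)+
  have L: "L = lattice" by (simp add: L lattice_def)
  have I_cont: "continuous_on (tube \<eta>) I"
    using I_holomorphic W(2) unfolding holomorphic_several_on_def
    by (meson continuous_at_imp_continuous_on has_derivative_continuous subsetD)
  let ?F = "deformed_integrand I h"
  have F_\<i>: "I (\<kappa> k) * det (complex_jacobian \<kappa> k) = ?F \<i> k" for k
    by (simp add: deformed_integrand_def complex_translate_def complex_jacobian_shift[OF h_C1 kappa] kappa)
  have F_0: "I (complexify k) = ?F 0 k" for k
    using deformed_integrand_of_real[of I h 0 k] by simp
  have F_cont: "continuous_on UNIV (?F s)" if "\<bar>Im s\<bar> \<le> 1" for s
  proof -
    have "continuous_on UNIV (\<lambda>k :: real ^ 'n. (s, k))" by (intro continuous_intros)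
    from continuous_on_compose2[OF continuous_on_deformed_integrand[OF I_cont h_C1 h_range] this]
    show ?thesis using that by auto
  qed
  \<comment> \<open>Periodicity of \<open>I\<close> is available on the tube only, hence the
    restriction on \<open>Im s\<close>.\<close>
  have F_per: "?F s (k + K) = ?F s k" if "\<bar>Im s\<bar> \<le> 1" "K \<in> L" for s k K
  proof -
    have "complex_translate h s (k + K) = complex_translate h s k + complexify K"
      by (simp add: complex_translate_def complexify_add h_periodic that(2))
    moreover have "complex_translate h s k \<in> tube \<eta>"
      using h_range that(1) by (rule complex_translate_in_tube)
    ultimately show ?thesis
      using I_periodic that(2) jacobian_shift[OF h_C1 h_periodic[OF that(2)]]
      by (simp add: deformed_integrand_def)
  qed
  \<comment> \<open>This is where the given cell \<open>B\<close> is exchanged for the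
    parallelepiped. Integrability over \<open>B\<close>, whatever its shape, is inherited from the
    bounded cell; the facts are then used at \<open>s = 0\<close> and
    \<open>s = \<i>\<close>.\<close>
  have cells: "set_integrable lebesgue B (?F s)"
    "(LINT k:B|lebesgue. ?F s k) = \<bar>det (matrix A)\<bar> *\<^sub>R integral (cbox 0 1) (\<lambda>u. ?F s (A u))"
    if s: "\<bar>Im s\<bar> \<le> 1" for s
  proof -
    have meas: "?F s \<in> borel_measurable lebesgue"
      using borel_measurable_continuous_onI[OF F_cont[OF s]] by (simp add: measurable_completion)
    note cong = set_integral_unit_cell_cong[OF countable_lattice uminus_lattice
        unit_cell_parallelepiped cell[unfolded L] meas F_per[OF s, unfolded L]
        set_integral_parallelepiped(1)[OF F_cont[OF s]]]
    show "set_integrable lebesgue B (?F s)" by (rule cong(1))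
    show "(LINT k:B|lebesgue. ?F s k) = \<bar>det (matrix A)\<bar> *\<^sub>R integral (cbox 0 1) (\<lambda>u. ?F s (A u))"
      using cong(2) set_integral_parallelepiped(2)[OF F_cont[OF s]] by simp
  qed
  have "integral (cbox 0 1) (\<lambda>u. ?F \<i> (A u)) = integral (cbox 0 1) (\<lambda>u. ?F 0 (A u))"
    unfolding F_0[symmetric]
  proof (rule integral_deformed_integrand[OF I_holomorphic W(2) I_cont h_C1 h_range])
    show "continuous_on UNIV (\<lambda>x. I (complexify x))"
      using F_cont[of 0] by (simp add: F_0)
    show "I (complexify (x + K)) = I (complexify x)" if "K \<in> lattice" for x K
      using F_per[of 0 K x] that by (simp add: F_0 L)
    show "h (x + K) = h x" if "K \<in> lattice" for x K
      using h_periodic that by (simp add: L)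
  qed
  then have "(LINT k:B|lebesgue. ?F 0 k) = (LINT k:B|lebesgue. ?F \<i> k)"
    using cells(2)[of 0] cells(2)[of \<i>] by simp
  moreover have "(LINT k:B|lebesgue. I (\<kappa> k) * det (complex_jacobian \<kappa> k)) =
         (LINT k:B|lebesgue. I (complexify k + \<i> *s complexify (h k)) *
            det (mat 1 + (\<chi> i j. \<i> * complex_of_real (jacobian h (at k) $ i $ j))))"
    by (simp add: complex_jacobian_shift[OF h_C1 kappa] kappa)
  ultimately show ?thesis
    using cells(1)[of 0] cells(1)[of \<i>] by (simp add: F_0 F_\<i>)
qed

end
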